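(* Let $X$ be a real Banach space, $K$ a nonempty subset of $X$, $A\colon X\to X^*$, $\varphi\colon X\times X\to\mathbb{R}$, $j\colon X\to\mathbb{R}$ and $f\in X^*$. Consider the variational-hemivariational inequality: find $u\in K$ such that $$\langle Au,v-u\rangle+\varphi(u,v)-\varphi(u,u)+j^0(u;v-u)\ge\langle f,v-u\rangle\quad\forall\,v\in K.\qquad (\mathrm{VHI})$$ Let $\mathcal{S}$ be the set of solutions of (VHI) and, for each $\varepsilon>0$, let $$\Omega(\varepsilon)=\{u\in K:\ \langle Au-f,v-u\rangle+\varphi(u,v)-\varphi(u,u)+j^0(u;v-u)\ge-\varepsilon\|u-v\|_X\ \ \forall\,v\in K\}.$$ The following statements hold. (a) Assume that $j$ is locally Lipschitz. Then (VHI) is well-posed if and only if $\mathcal{S}$ is nonempty and $\operatorname{diam}(\Omega(\varepsilon))\to0$ as $\varepsilon\to0$. (b) Assume that: $K$ is a closed subset of $X$; $A$ is a pseudomonotone operator; for every sequence $\{u_n\}\subset X$ and $u\in X$ such that $u_n\to u$ in $X$ and every $v\in X$ one has $$\limsup_{n\to\infty}\big(\varphi(u_n,v)-\varphi(u_n,u_n)\big)\le\varphi(u,v)-\varphi(u,u);$$ and $j$ is locally Lipschitz. Then (VHI) is well-posed if and only if $\Omega(\varepsilon)$ is nonempty for each $\varepsilon>0$ and $\operatorname{diam}(\Omega(\varepsilon))\to0$ as $\varepsilon\to0$.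
   Context: $\langle\cdot,\cdot\rangle$ is the duality pairing between $X^*$ and $X$; $\to$ and $\rightharpoonup$ denote strong and weak convergence in $X$. For a locally Lipschitz function $j\colon X\to\mathbb{R}$ (each point has a neighborhood on which $j$ is Lipschitz continuous), the generalized (Clarke) directional derivative of $j$ at $u$ in the direction $v$ is $j^0(u;v)=\limsup_{x\to u,\ \lambda\downarrow0}\frac{j(x+\lambda v)-j(x)}{\lambda}$. An operator $A\colon X\to X^*$ is bounded if it maps bounded sets to bounded sets. It is pseudomonotone if it is bounded and whenever $u_n\rightharpoonup u$ in $X$ with $\limsup\langle Au_n,u_n-u\rangle\le0$, one has $\liminf\langle Au_n,u_n-v\rangle\ge\langle Au,u-v\rangle$ for all $v\in X$. A sequence $\{u_n\}\subset K$ is an approximating sequence for (VHI) if there exists a sequence $\{\varepsilon_n\}\subset\mathbb{R}$ with $0<\varepsilon_n\to0$ such that for each $n\in\mathbb{N}$ $$\langle Au_n,v-u_n\rangle+\varphi(u_n,v)-\varphi(u_n,u_n)+j^0(u_n;v-u_n)\ge\langle f,v-u_n\rangle-\varepsilon_n\|u_n-v\|_X\quad\forall\,v\in K.$$ (VHI) is well-posed (in the sense of Tykhonov) if it has a unique solution and every approximating sequence for (VHI) converges strongly in $X$ to that solution. For a nonempty set $\Omega\subset X$, $\operatorname{diam}(\Omega)=\sup_{a,b\in\Omega}\|a-b\|_X$ (possibly $+\infty$). *)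

theory Defs
  imports "HOL-Analysis.Analysis"
begin

definition locally_lipschitz :: "('a::real_normed_vector \<Rightarrow> real) \<Rightarrow> bool" where
  "locally_lipschitz j \<longleftrightarrow> (\<forall>u. \<exists>U L. open U \<and> u \<in> U \<and> L-lipschitz_on U j)"

text \<open>
  The base point \<open>x\<close> ranges over full neighbourhoods of \<open>u\<close> (\<open>x = u\<close> is allowed). The upper limit
  is taken in the extended reals and is finite for locally Lipschitz \<open>j\<close>
  (\<open>ereal_clarke_deriv\<close> below), so the conversion to \<open>real\<close> loses nothing there;
  for other \<open>j\<close> the value is meaningless.
\<close>

definition clarke_deriv :: "('a::real_normed_vector \<Rightarrow> real) \<Rightarrow> 'a \<Rightarrow> 'a \<Rightarrow> real" where
  "clarke_deriv j u v = real_of_ereal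
     (Limsup (nhds u \<times>\<^sub>F at_right 0) (\<lambda>(x, l). ereal ((j (x + l *\<^sub>R v) - j x) / l)))"

lemma ereal_clarke_deriv:
  fixes j :: "'a::real_normed_vector \<Rightarrow> real"
  assumes "locally_lipschitz j"
  shows "ereal (clarke_deriv j u v) =
    Limsup (nhds u \<times>\<^sub>F at_right 0) (\<lambda>(x, l). ereal ((j (x + l *\<^sub>R v) - j x) / l))"
proof -
  define F :: "('a \<times> real) filter" where "F = nhds u \<times>\<^sub>F at_right 0"
  define q where "q = (\<lambda>(x, l). ereal ((j (x + l *\<^sub>R v) - j x) / l))"
  obtain U L where U: "open U" "u \<in> U" and L: "L-lipschitz_on U j"
    using assms unfolding locally_lipschitz_def by blast
  have nontrivial: "F \<noteq> bot"
    by (simp add: F_def prod_filter_eq_bot)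
  have fst_lim: "(fst \<longlongrightarrow> u) F"
    unfolding F_def using filterlim_fst by blast
  have snd_lim: "filterlim snd (at_right 0) F"
    unfolding F_def by (rule filterlim_snd)
  then have "(snd \<longlongrightarrow> 0) F"
    by (simp add: filterlim_at)
  with fst_lim have "((\<lambda>p. fst p + snd p *\<^sub>R v) \<longlongrightarrow> u + 0 *\<^sub>R v) F"
    by (intro tendsto_intros)
  then have "eventually (\<lambda>p. fst p + snd p *\<^sub>R v \<in> U) F"
    using U by (intro topological_tendstoD) auto
  moreover have "eventually (\<lambda>p. fst p \<in> U) F"
    using fst_lim U by (intro topological_tendstoD) auto
  moreover have "eventually (\<lambda>p. snd p > 0) F"
    using snd_lim by (auto simp: filterlim_at elim: eventually_mono)
  ultimately have "eventually (\<lambda>p. ereal (- (L * norm v)) \<le> q p \<and> q p \<le> ereal (L * norm v)) F"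
  proof eventually_elim
    case (elim p)
    obtain x l where p: "p = (x, l)" by (cases p)
    have "\<bar>j (x + l *\<^sub>R v) - j x\<bar> \<le> L * norm v * l"
      using lipschitz_onD[OF L, of "x + l *\<^sub>R v" x] elim
      by (simp add: p dist_norm mult_ac)
    then show ?case
      using elim by (auto simp: p q_def field_simps abs_le_iff)
  qed
  then have lo: "eventually (\<lambda>p. ereal (- (L * norm v)) \<le> q p) F"
    and hi: "eventually (\<lambda>p. q p \<le> ereal (L * norm v)) F"
    by (auto elim: eventually_mono)
  have "ereal (- (L * norm v)) \<le> Limsup F q" "Limsup F q \<le> ereal (L * norm v)"
    by (rule le_Limsup[OF nontrivial lo], rule Limsup_bounded[OF hi])
  then have "\<bar>Limsup F q\<bar> \<noteq> \<infinity>"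
    by auto
  then show ?thesis
    by (simp add: clarke_deriv_def F_def[symmetric] q_def[symmetric] ereal_real)
qed

definition weakly_convergent_to :: "(nat \<Rightarrow> 'a::real_normed_vector) \<Rightarrow> 'a \<Rightarrow> bool" where
  "weakly_convergent_to x u \<longleftrightarrow> (\<forall>g :: 'a \<Rightarrow>\<^sub>L real. (\<lambda>n. g (x n)) \<longlonglongrightarrow> g u)"

definition bounded_operator ::
    "('a::real_normed_vector \<Rightarrow> 'b::real_normed_vector) \<Rightarrow> bool" where
  "bounded_operator A \<longleftrightarrow> (\<forall>B. bounded B \<longrightarrow> bounded (A ` B))"

definition pseudomonotone :: "('a::real_normed_vector \<Rightarrow> 'a \<Rightarrow>\<^sub>L real) \<Rightarrow> bool" where
  "pseudomonotone A \<longleftrightarrow> bounded_operator A \<and>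
     (\<forall>x u. weakly_convergent_to x u \<and> limsup (\<lambda>n. ereal (A (x n) (x n - u))) \<le> 0 \<longrightarrow>
        (\<forall>v. ereal (A u (u - v)) \<le> liminf (\<lambda>n. ereal (A (x n) (x n - v)))))"

definition vhi_solutions ::
    "'a::real_normed_vector set \<Rightarrow> ('a \<Rightarrow> 'a \<Rightarrow>\<^sub>L real) \<Rightarrow> ('a \<Rightarrow> 'a \<Rightarrow> real) \<Rightarrow> ('a \<Rightarrow> real) \<Rightarrow>
      ('a \<Rightarrow>\<^sub>L real) \<Rightarrow> 'a set" where
  "vhi_solutions K A \<phi> j f = {u \<in> K. \<forall>v\<in>K.
     A u (v - u) + \<phi> u v - \<phi> u u + clarke_deriv j u (v - u) \<ge> f (v - u)}"

definition vhi_approx_set ::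
    "'a::real_normed_vector set \<Rightarrow> ('a \<Rightarrow> 'a \<Rightarrow>\<^sub>L real) \<Rightarrow> ('a \<Rightarrow> 'a \<Rightarrow> real) \<Rightarrow> ('a \<Rightarrow> real) \<Rightarrow>
      ('a \<Rightarrow>\<^sub>L real) \<Rightarrow> real \<Rightarrow> 'a set" where
  "vhi_approx_set K A \<phi> j f \<epsilon> = {u \<in> K. \<forall>v\<in>K.
     (A u - f) (v - u) + \<phi> u v - \<phi> u u + clarke_deriv j u (v - u) \<ge> - \<epsilon> * norm (u - v)}"

definition vhi_approximating_seq ::
    "'a::real_normed_vector set \<Rightarrow> ('a \<Rightarrow> 'a \<Rightarrow>\<^sub>L real) \<Rightarrow> ('a \<Rightarrow> 'a \<Rightarrow> real) \<Rightarrow> ('a \<Rightarrow> real) \<Rightarrow>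
      ('a \<Rightarrow>\<^sub>L real) \<Rightarrow> (nat \<Rightarrow> 'a) \<Rightarrow> bool" where
  "vhi_approximating_seq K A \<phi> j f x \<longleftrightarrow> (\<forall>n. x n \<in> K) \<and>
     (\<exists>e :: nat \<Rightarrow> real. (\<forall>n. 0 < e n) \<and> e \<longlonglongrightarrow> 0 \<and>
       (\<forall>n. \<forall>v\<in>K.
          A (x n) (v - x n) + \<phi> (x n) v - \<phi> (x n) (x n) + clarke_deriv j (x n) (v - x n)
            \<ge> f (v - x n) - e n * norm (x n - v)))"

definition vhi_well_posed ::
    "'a::real_normed_vector set \<Rightarrow> ('a \<Rightarrow> 'a \<Rightarrow>\<^sub>L real) \<Rightarrow> ('a \<Rightarrow> 'a \<Rightarrow> real) \<Rightarrow> ('a \<Rightarrow> real) \<Rightarrow>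
      ('a \<Rightarrow>\<^sub>L real) \<Rightarrow> bool" where
  "vhi_well_posed K A \<phi> j f \<longleftrightarrow>
     (\<exists>u. vhi_solutions K A \<phi> j f = {u} \<and> (\<forall>x. vhi_approximating_seq K A \<phi> j f x \<longrightarrow> x \<longlonglongrightarrow> u))"

text \<open>
  Unlike the real-valued library constant \<open>diameter\<close>, this is \<open>\<infinity>\<close> on unbounded sets.
\<close>

definition ediam :: "'a::real_normed_vector set \<Rightarrow> ereal" where
  "ediam S = (SUP (a, b) \<in> S \<times> S. ereal (norm (a - b)))"

end

theory Submission
  imports Defs
begin

text \<open>
  Every solution lies in every \<open>\<Omega>(\<epsilon>)\<close>, and an approximating sequence is one whose terms lie in
  \<open>\<Omega>(\<epsilon>\<^sub>n)\<close> for some positive \<open>\<epsilon>\<^sub>n \<rightarrow> 0\<close>. Hence, once a solution \<open>u\<close> exists, small diameters of \<open>\<Omega>(\<epsilon>)\<close> force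
  approximating sequences towards \<open>u\<close>. Conversely, if the diameters stay above some \<open>r > 0\<close>,
  then two points at distance more than \<open>r\<close> can be picked in each \<open>\<Omega>(1/n)\<close>, and the two resulting
  approximating sequences cannot have a common limit. This is the first equivalence
  (\<open>vhi_well_posed_iff_diam\<close>).

  For the second equivalence it remains to produce a solution from the nonemptiness of the sets
  \<open>\<Omega>(\<epsilon>)\<close>. They are nested, so points \<open>u\<^sub>n \<in> \<Omega>(1/n)\<close> form a Cauchy sequence as soon as the diameters
  vanish, and its limit \<open>u\<close> lies in \<open>K\<close>. One passes to the limit in the inequality for \<open>u\<^sub>n\<close>
  (\<open>limit_of_approx_points_is_solution\<close>). Boundedness of \<open>A\<close> gives \<open>\<langle>A u\<^sub>n, u\<^sub>n - u\<rangle> \<rightarrow> 0\<close>, so that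
  pseudomonotonicity applies; the \<open>\<phi>\<close> terms are controlled by hypothesis; and the Clarke
  derivative is jointly upper semicontinuous in base point and direction
  (\<open>clarke_deriv_usc\<close>), being upper semicontinuous in the base point and Lipschitz in the direction
  locally uniformly in the base point.
\<close>

section \<open>Upper semicontinuity of the Clarke derivative\<close>

text \<open>The finiteness of the upper limit lets one argue with real thresholds from here on.\<close>

lemma clarke_deriv_le_iff:
  assumes "locally_lipschitz j"
  shows "clarke_deriv j u v \<le> c \<longleftrightarrow>
    (\<forall>y>c. eventually (\<lambda>(x, l). (j (x + l *\<^sub>R v) - j x) / l < y) (nhds u \<times>\<^sub>F at_right 0))"
    (is "_ \<longleftrightarrow> ?R")
proof -
  define F where "F = nhds u \<times>\<^sub>F at_right (0::real)"
  define q where "q = (\<lambda>(x, l). (j (x + l *\<^sub>R v) - j x) / l)"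
  have eq: "ereal (clarke_deriv j u v) = Limsup F (\<lambda>p. ereal (q p))"
    using ereal_clarke_deriv[OF assms, of u v] by (simp add: F_def q_def case_prod_unfold)
  have "clarke_deriv j u v \<le> c \<longleftrightarrow> Limsup F (\<lambda>p. ereal (q p)) \<le> ereal c"
    by (simp flip: eq)
  also have "\<dots> \<longleftrightarrow> (\<forall>y>c. eventually (\<lambda>p. q p < y) F)"
  proof
    assume *: "Limsup F (\<lambda>p. ereal (q p)) \<le> ereal c"
    show "\<forall>y>c. eventually (\<lambda>p. q p < y) F"
    proof (intro allI impI)
      fix y assume "c < y"
      then have "Limsup F (\<lambda>p. ereal (q p)) < ereal y"
        using * by (simp add: le_less_trans)
      from Limsup_lessD[OF this] show "eventually (\<lambda>p. q p < y) F"
        by simp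
    qed
  next
    assume *: "\<forall>y>c. eventually (\<lambda>p. q p < y) F"
    have "clarke_deriv j u v \<le> y" if "c < y" for y
    proof -
      have "eventually (\<lambda>p. ereal (q p) \<le> ereal y) F"
        using *[rule_format, OF that] by eventually_elim simp
      from Limsup_bounded[OF this] show ?thesis
        by (simp flip: eq)
    qed
    then show "Limsup F (\<lambda>p. ereal (q p)) \<le> ereal c"
      by (simp flip: eq add: dense_ge)
  qed
  finally show ?thesis
    by (simp add: F_def q_def case_prod_unfold)
qed

lemma clarke_deriv_usc_base:
  assumes "locally_lipschitz j" and "clarke_deriv j u v < c"
  shows "eventually (\<lambda>x. clarke_deriv j x v \<le> c) (nhds u)"
proof -
  obtain P Q where P: "eventually P (nhds u)" and Q: "eventually Q (at_right (0::real))"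
    and PQ: "\<And>x l. P x \<Longrightarrow> Q l \<Longrightarrow> (j (x + l *\<^sub>R v) - j x) / l < c"
    using clarke_deriv_le_iff[OF assms(1), of u v "clarke_deriv j u v"] assms(2)
    unfolding eventually_prod_filter by auto
  \<comment> \<open>A neighbourhood of \<open>u\<close> is a neighbourhood of all points close to \<open>u\<close>, so one bound on the
      quotients serves all of these base points.\<close>
  from P have "eventually (\<lambda>x. eventually P (nhds x)) (nhds u)"
    by (simp add: eventually_eventually)
  then show ?thesis
  proof eventually_elim
    case (elim x)
    have "eventually (\<lambda>(y, l). (j (y + l *\<^sub>R v) - j y) / l < c) (nhds x \<times>\<^sub>F at_right 0)"
      unfolding eventually_prod_filter using elim Q PQ by auto
    then show ?case
      by (auto simp: clarke_deriv_le_iff[OF assms(1)] elim: eventually_mono)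
  qed
qed

text \<open>
  Changing the direction from \<open>v\<close> to \<open>w\<close> moves the endpoint \<open>y + l w\<close> of a difference quotient by
  \<open>l \<bar>w - v\<bar>\<close>, hence the quotient itself by at most \<open>L \<bar>w - v\<bar>\<close>.
\<close>

lemma clarke_deriv_lipschitz_direction:
  fixes j :: "'a::real_normed_vector \<Rightarrow> real"
  assumes "locally_lipschitz j" and U: "open U" "x \<in> U" and L: "L-lipschitz_on U j"
  shows "clarke_deriv j x w \<le> clarke_deriv j x v + L * norm (w - v)"
  unfolding clarke_deriv_le_iff[OF assms(1)]
proof (intro allI impI)
  fix y assume y: "clarke_deriv j x v + L * norm (w - v) < y"
  define F :: "('a \<times> real) filter" where "F = nhds x \<times>\<^sub>F at_right 0"
  have fst_lim: "(fst \<longlongrightarrow> x) F"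
    unfolding F_def using filterlim_fst by blast
  have snd_lim: "filterlim snd (at_right 0) F"
    unfolding F_def by (rule filterlim_snd)
  then have snd_0: "(snd \<longlongrightarrow> 0) F"
    by (simp add: filterlim_at)
  have in_U: "eventually (\<lambda>p. fst p + snd p *\<^sub>R d \<in> U) F" for d
  proof -
    have "((\<lambda>p. fst p + snd p *\<^sub>R d) \<longlongrightarrow> x + 0 *\<^sub>R d) F"
      using fst_lim snd_0 by (intro tendsto_intros)
    then show ?thesis
      using U by (intro topological_tendstoD) auto
  qed
  have pos: "eventually (\<lambda>p. snd p > 0) F"
    using snd_lim by (auto simp: filterlim_at elim: eventually_mono)
  have "clarke_deriv j x v < y - L * norm (w - v)"
    using y by simp
  then have "eventually (\<lambda>(z, l). (j (z + l *\<^sub>R v) - j z) / l < y - L * norm (w - v)) F"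
    using clarke_deriv_le_iff[OF assms(1), of x v "clarke_deriv j x v"] by (simp add: F_def)
  with pos in_U[of v] in_U[of w]
  have "eventually (\<lambda>(z, l). (j (z + l *\<^sub>R w) - j z) / l < y) F"
  proof eventually_elim
    case (elim p)
    obtain z l where p: "p = (z, l)" by (cases p)
    have "(z + l *\<^sub>R w) - (z + l *\<^sub>R v) = l *\<^sub>R (w - v)"
      by (simp add: algebra_simps)
    then have "\<bar>j (z + l *\<^sub>R w) - j (z + l *\<^sub>R v)\<bar> \<le> L * (l * norm (w - v))"
      using lipschitz_onD[OF L, of "z + l *\<^sub>R w" "z + l *\<^sub>R v"] elim
      by (simp add: p dist_norm)
    moreover have "j (z + l *\<^sub>R v) - j z < (y - L * norm (w - v)) * l"
      using elim by (simp add: p pos_divide_less_eq)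
    ultimately have "j (z + l *\<^sub>R w) - j z < y * l"
      by (simp add: algebra_simps abs_le_iff)
    then show ?case
      using elim by (simp add: p pos_divide_less_eq)
  qed
  then show "eventually (\<lambda>(z, l). (j (z + l *\<^sub>R w) - j z) / l < y) (nhds x \<times>\<^sub>F at_right 0)"
    by (simp add: F_def)
qed

lemma clarke_deriv_usc:
  assumes j: "locally_lipschitz j"
    and x: "(x \<longlongrightarrow> u) G" and w: "(w \<longlongrightarrow> v) G" and c: "clarke_deriv j u v < c"
  shows "eventually (\<lambda>n. clarke_deriv j (x n) (w n) < c) G"
proof -
  obtain U L where U: "open U" "u \<in> U" and L: "L-lipschitz_on U j"
    using j unfolding locally_lipschitz_def by blast
  obtain c' where c': "clarke_deriv j u v < c'" "c' < c"
    using c dense by blast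
  have "eventually (\<lambda>n. clarke_deriv j (x n) v \<le> c') G"
    using clarke_deriv_usc_base[OF j c'(1)] x unfolding filterlim_iff by blast
  moreover have "eventually (\<lambda>n. x n \<in> U) G"
    using x U by (rule topological_tendstoD)
  moreover have "((\<lambda>n. L * norm (w n - v)) \<longlongrightarrow> L * norm (v - v)) G"
    by (intro tendsto_intros w)
  then have "eventually (\<lambda>n. L * norm (w n - v) < c - c') G"
    by (rule order_tendstoD) (use c' in simp)
  ultimately show ?thesis
  proof eventually_elim
    case (elim n)
    with clarke_deriv_lipschitz_direction[OF j U(1) elim(2) L, of "w n" v] show ?case
      by linarith
  qed
qed

section \<open>Vanishing diameters of nested families\<close>

text \<open>
  Nonemptiness is essential for the direction from right to left: the empty set has diameter
  \<open>-\<infinity>\<close>, and a family of eventually empty sets does not have diameters tending to \<open>0\<close>.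
\<close>

lemma ediam_tendsto_0_iff:
  fixes \<Omega> :: "real \<Rightarrow> 'a::real_normed_vector set"
  assumes mono: "\<And>\<epsilon> \<delta>. \<epsilon> \<le> \<delta> \<Longrightarrow> \<Omega> \<epsilon> \<subseteq> \<Omega> \<delta>"
    and nonempty: "\<And>\<epsilon>. \<epsilon> > 0 \<Longrightarrow> \<Omega> \<epsilon> \<noteq> {}"
  shows "((\<lambda>\<epsilon>. ediam (\<Omega> \<epsilon>)) \<longlongrightarrow> 0) (at_right 0) \<longleftrightarrow>
    (\<forall>r>0. \<exists>\<delta>>0. \<forall>a\<in>\<Omega> \<delta>. \<forall>b\<in>\<Omega> \<delta>. norm (a - b) < r)"
    (is "?lhs \<longleftrightarrow> ?rhs")
proof
  have le: "ereal (norm (a - b)) \<le> ediam S" if "a \<in> S" "b \<in> S" for a b :: 'a and S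
    unfolding ediam_def by (rule SUP_upper2[of "(a, b)"]) (use that in auto)
  show ?rhs if ?lhs
  proof (intro allI impI)
    fix r :: real assume "r > 0"
    with that have "eventually (\<lambda>\<epsilon>. ediam (\<Omega> \<epsilon>) < ereal r) (at_right 0)"
      by (intro order_tendstoD) auto
    then obtain d where "d > 0" and d: "\<And>\<epsilon>. 0 < \<epsilon> \<Longrightarrow> \<epsilon> < d \<Longrightarrow> ediam (\<Omega> \<epsilon>) < ereal r"
      unfolding eventually_at_right_field by auto
    then have "ediam (\<Omega> (d / 2)) < ereal r"
      by simp
    then have "\<forall>a\<in>\<Omega> (d / 2). \<forall>b\<in>\<Omega> (d / 2). norm (a - b) < r"
      using le le_less_trans by (metis less_ereal.simps(1))
    with \<open>d > 0\<close> show "\<exists>\<delta>>0. \<forall>a\<in>\<Omega> \<delta>. \<forall>b\<in>\<Omega> \<delta>. norm (a - b) < r"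
      by (intro exI[of _ "d / 2"]) auto
  qed
  show ?lhs if small: ?rhs
  proof (rule order_tendstoI)
    fix y :: ereal assume "y < 0"
    have "eventually (\<lambda>\<epsilon>::real. 0 < \<epsilon>) (at_right 0)"
      by (simp add: eventually_at_right_less)
    then show "eventually (\<lambda>\<epsilon>. y < ediam (\<Omega> \<epsilon>)) (at_right 0)"
    proof eventually_elim
      case (elim \<epsilon>)
      then obtain a where "a \<in> \<Omega> \<epsilon>"
        using nonempty by auto
      then have "0 \<le> ediam (\<Omega> \<epsilon>)"
        using le[of a "\<Omega> \<epsilon>" a] by (simp add: zero_ereal_def)
      with \<open>y < 0\<close> show ?case
        by (rule less_le_trans)
    qed
  next
    fix y :: ereal assume "0 < y"
    then obtain r where r: "0 < ereal r" "ereal r < y"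
      using ereal_dense2 by blast
    then obtain d where "d > 0" and d: "\<And>a b. a \<in> \<Omega> d \<Longrightarrow> b \<in> \<Omega> d \<Longrightarrow> norm (a - b) < r"
      using small by (metis ereal_less(2))
    have "eventually (\<lambda>\<epsilon>. \<epsilon> < d) (at_right 0)"
      using \<open>d > 0\<close> by (auto simp: eventually_at_right_field)
    then show "eventually (\<lambda>\<epsilon>. ediam (\<Omega> \<epsilon>) < y) (at_right 0)"
    proof eventually_elim
      case (elim \<epsilon>)
      then have "\<Omega> \<epsilon> \<subseteq> \<Omega> d"
        by (intro mono) simp
      then have "ediam (\<Omega> \<epsilon>) \<le> ereal r"
        unfolding ediam_def by (intro SUP_least) (auto intro!: less_imp_le d)
      with r show ?case
        by (simp add: le_less_trans)
    qed
  qed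
qed

section \<open>Well-posedness and approximate solutions\<close>

lemma vhi_approx_set_mono:
  assumes "\<epsilon> \<le> \<delta>"
  shows "vhi_approx_set K A \<phi> j f \<epsilon> \<subseteq> vhi_approx_set K A \<phi> j f \<delta>"
proof -
  have "- \<delta> * norm d \<le> - \<epsilon> * norm d" for d :: 'a
    using assms by (simp add: mult_right_mono)
  then show ?thesis
    unfolding vhi_approx_set_def by (blast intro: order_trans)
qed

lemma vhi_solutions_subset_approx:
  assumes "\<epsilon> \<ge> 0"
  shows "vhi_solutions K A \<phi> j f \<subseteq> vhi_approx_set K A \<phi> j f \<epsilon>"
proof -
  have "vhi_solutions K A \<phi> j f = vhi_approx_set K A \<phi> j f 0"
    unfolding vhi_solutions_def vhi_approx_set_def by (auto simp: blinfun.diff_left algebra_simps)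
  with vhi_approx_set_mono[OF assms] show ?thesis
    by metis
qed

lemma vhi_approximating_seq_iff:
  "vhi_approximating_seq K A \<phi> j f x \<longleftrightarrow>
    (\<exists>e. (\<forall>n. 0 < e n) \<and> e \<longlonglongrightarrow> 0 \<and> (\<forall>n. x n \<in> vhi_approx_set K A \<phi> j f (e n)))"
proof -
  have "x n \<in> vhi_approx_set K A \<phi> j f \<epsilon> \<longleftrightarrow> x n \<in> K \<and>
     (\<forall>v\<in>K. A (x n) (v - x n) + \<phi> (x n) v - \<phi> (x n) (x n) + clarke_deriv j (x n) (v - x n)
            \<ge> f (v - x n) - \<epsilon> * norm (x n - v))" for n \<epsilon>
    unfolding vhi_approx_set_def by (auto simp: blinfun.diff_left algebra_simps)
  then show ?thesis
    unfolding vhi_approximating_seq_def by auto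
qed

theorem vhi_well_posed_iff_diam:
  "vhi_well_posed K A \<phi> j f \<longleftrightarrow> vhi_solutions K A \<phi> j f \<noteq> {} \<and>
    ((\<lambda>\<epsilon>. ediam (vhi_approx_set K A \<phi> j f \<epsilon>)) \<longlongrightarrow> 0) (at_right 0)"
proof (cases "vhi_solutions K A \<phi> j f = {}")
  case True
  then show ?thesis
    by (simp add: vhi_well_posed_def)
next
  case False
  define S where "S = vhi_solutions K A \<phi> j f"
  define \<Omega> where "\<Omega> = vhi_approx_set K A \<phi> j f"
  have sol: "S \<subseteq> \<Omega> \<epsilon>" if "\<epsilon> > 0" for \<epsilon>
    using that by (simp add: S_def \<Omega>_def vhi_solutions_subset_approx)
  have mono: "\<Omega> \<epsilon> \<subseteq> \<Omega> \<delta>" if "\<epsilon> \<le> \<delta>" for \<epsilon> \<delta>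
    using that by (simp add: \<Omega>_def vhi_approx_set_mono)
  have nonempty: "\<Omega> \<epsilon> \<noteq> {}" if "\<epsilon> > 0" for \<epsilon>
    using sol[OF that] False by (auto simp: S_def)
  have "vhi_well_posed K A \<phi> j f \<longleftrightarrow> (\<forall>r>0. \<exists>\<delta>>0. \<forall>a\<in>\<Omega> \<delta>. \<forall>b\<in>\<Omega> \<delta>. norm (a - b) < r)"
    (is "_ \<longleftrightarrow> ?small")
  proof
    assume "vhi_well_posed K A \<phi> j f"
    then obtain u where u: "\<And>x. vhi_approximating_seq K A \<phi> j f x \<Longrightarrow> x \<longlonglongrightarrow> u"
      unfolding vhi_well_posed_def by blast
    show ?small
    proof (rule ccontr)
      assume "\<not> ?small"
      then obtain r where "r > 0"
        and r: "\<And>\<delta>. \<delta> > 0 \<Longrightarrow> \<exists>a\<in>\<Omega> \<delta>. \<exists>b\<in>\<Omega> \<delta>. norm (a - b) \<ge> r"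
        by (meson not_less)
      define e where "e n = inverse (real (Suc n))" for n
      have e: "e n > 0" "e \<longlonglongrightarrow> 0" for n
        unfolding e_def by (simp, rule LIMSEQ_inverse_real_of_nat)
      obtain a b where ab: "\<And>n. a n \<in> \<Omega> (e n)" "\<And>n. b n \<in> \<Omega> (e n)"
          "\<And>n. norm (a n - b n) \<ge> r"
        using r[OF e(1)] by metis
      then have "vhi_approximating_seq K A \<phi> j f a" "vhi_approximating_seq K A \<phi> j f b"
        using e unfolding vhi_approximating_seq_iff \<Omega>_def by blast+
      then have "a \<longlonglongrightarrow> u" "b \<longlonglongrightarrow> u"
        by (auto intro: u)
      then have "(\<lambda>n. norm (a n - b n)) \<longlonglongrightarrow> norm (u - u)"
        by (intro tendsto_intros)
      then have "r \<le> norm (u - u)"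
        by (rule LIMSEQ_le_const) (use ab in auto)
      with \<open>r > 0\<close> show False
        by simp
    qed
  next
    assume small: ?small
    obtain u where u: "u \<in> S"
      using False by (auto simp: S_def)
    have "u' = u" if "u' \<in> S" for u'
    proof (rule ccontr)
      assume "u' \<noteq> u"
      then have "norm (u' - u) > 0"
        by simp
      then obtain d where "d > 0" "\<forall>a\<in>\<Omega> d. \<forall>b\<in>\<Omega> d. norm (a - b) < norm (u' - u)"
        using small by blast
      then show False
        using sol[of d] u that by blast
    qed
    with u have "S = {u}"
      by blast
    moreover have "x \<longlonglongrightarrow> u" if x: "vhi_approximating_seq K A \<phi> j f x" for x
    proof (rule tendstoI)
      fix r :: real assume "r > 0"
      then obtain d where "d > 0" and d: "\<forall>a\<in>\<Omega> d. \<forall>b\<in>\<Omega> d. norm (a - b) < r"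
        using small by blast
      obtain e where e: "e \<longlonglongrightarrow> 0" "\<And>n. x n \<in> \<Omega> (e n)"
        using x by (auto simp: vhi_approximating_seq_iff \<Omega>_def)
      have "eventually (\<lambda>n. e n < d) sequentially"
        using e(1) \<open>d > 0\<close> by (rule order_tendstoD)
      then show "eventually (\<lambda>n. dist (x n) u < r) sequentially"
      proof eventually_elim
        case (elim n)
        then have "x n \<in> \<Omega> d"
          using e(2)[of n] mono[of "e n" d] by auto
        then show ?case
          using d sol[OF \<open>d > 0\<close>] u by (auto simp: dist_norm)
      qed
    qed
    ultimately show "vhi_well_posed K A \<phi> j f"
      by (auto simp: vhi_well_posed_def S_def)
  qed
  also have "\<dots> \<longleftrightarrow> ((\<lambda>\<epsilon>. ediam (\<Omega> \<epsilon>)) \<longlongrightarrow> 0) (at_right 0)"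
    by (rule ediam_tendsto_0_iff[symmetric]) (use mono nonempty in auto)
  finally show ?thesis
    using False by (simp add: \<Omega>_def)
qed

section \<open>Limits of approximate solutions\<close>

lemma weakly_convergent_to_of_tendsto:
  "x \<longlonglongrightarrow> u \<Longrightarrow> weakly_convergent_to x u"
  unfolding weakly_convergent_to_def by (auto intro: tendsto_intros)

text \<open>
  Along a strongly convergent sequence the hypothesis on \<open>limsup \<langle>A x\<^sub>n, x\<^sub>n - u\<rangle>\<close> is automatic: \<open>A x\<^sub>n\<close>
  stays bounded while \<open>x\<^sub>n - u\<close> vanishes.
\<close>

lemma pseudomonotone_strong_limit:
  assumes A: "pseudomonotone A" and x: "x \<longlonglongrightarrow> u" and c: "A u (v - u) < c"
  shows "eventually (\<lambda>n. A (x n) (v - x n) < c) sequentially"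
proof -
  have "bounded (A ` range x)"
    using A convergent_imp_bounded[OF x] unfolding pseudomonotone_def bounded_operator_def by blast
  then obtain M where M: "\<And>n. norm (A (x n)) \<le> M"
    by (auto simp: bounded_iff)
  have "(\<lambda>n. A (x n) (x n - u)) \<longlonglongrightarrow> 0"
  proof (rule Lim_null_comparison)
    show "eventually (\<lambda>n. norm (A (x n) (x n - u)) \<le> M * norm (x n - u)) sequentially"
      by (intro always_eventually allI order_trans[OF norm_blinfun] mult_right_mono M) simp
    have "(\<lambda>n. M * norm (x n - u)) \<longlonglongrightarrow> M * norm (u - u)"
      by (intro tendsto_intros x)
    then show "(\<lambda>n. M * norm (x n - u)) \<longlonglongrightarrow> 0"
      by simp
  qed
  then have "limsup (\<lambda>n. ereal (A (x n) (x n - u))) = ereal 0"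
    by (intro lim_imp_Limsup) auto
  then have "ereal (A u (u - v)) \<le> liminf (\<lambda>n. ereal (A (x n) (x n - v)))"
    using A weakly_convergent_to_of_tendsto[OF x]
    unfolding pseudomonotone_def by (simp add: zero_ereal_def)
  moreover have "ereal (- c) < ereal (A u (u - v))"
    using c by (simp add: blinfun.diff_right)
  ultimately have "ereal (- c) < liminf (\<lambda>n. ereal (A (x n) (x n - v)))"
    by (rule less_le_trans[rotated])
  from less_LiminfD[OF this] show ?thesis
    by eventually_elim (simp add: blinfun.diff_right)
qed

lemma limit_of_approx_points_is_solution:
  assumes K: "closed K" and A: "pseudomonotone A"
    and \<phi>: "\<And>v. limsup (\<lambda>n. ereal (\<phi> (x n) v - \<phi> (x n) (x n))) \<le> ereal (\<phi> u v - \<phi> u u)"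
    and j: "locally_lipschitz j"
    and x: "x \<longlonglongrightarrow> u" and e: "e \<longlonglongrightarrow> 0"
    and approx: "\<And>n. x n \<in> vhi_approx_set K A \<phi> j f (e n)"
  shows "u \<in> vhi_solutions K A \<phi> j f"
  unfolding vhi_solutions_def
proof (intro CollectI conjI ballI)
  show "u \<in> K"
    using closed_sequentially[OF K _ x] approx by (auto simp: vhi_approx_set_def)
  fix v assume v: "v \<in> K"
  show "f (v - u) \<le> A u (v - u) + \<phi> u v - \<phi> u u + clarke_deriv j u (v - u)"
  proof (rule field_le_epsilon)
    fix \<eta> :: real assume "\<eta> > 0"
    have "eventually (\<lambda>n. A (x n) (v - x n) < A u (v - u) + \<eta> / 3) sequentially"
      by (rule pseudomonotone_strong_limit[OF A x]) (use \<open>\<eta> > 0\<close> in simp)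
    moreover have "limsup (\<lambda>n. ereal (\<phi> (x n) v - \<phi> (x n) (x n))) < ereal (\<phi> u v - \<phi> u u + \<eta> / 3)"
      by (rule le_less_trans[OF \<phi>]) (use \<open>\<eta> > 0\<close> in simp)
    from Limsup_lessD[OF this]
    have "eventually (\<lambda>n. \<phi> (x n) v - \<phi> (x n) (x n) < \<phi> u v - \<phi> u u + \<eta> / 3) sequentially"
      by simp
    moreover have "(\<lambda>n. v - x n) \<longlonglongrightarrow> v - u"
      by (intro tendsto_intros x)
    then have "eventually (\<lambda>n. clarke_deriv j (x n) (v - x n) < clarke_deriv j u (v - u) + \<eta> / 3)
        sequentially"
      by (rule clarke_deriv_usc[OF j x]) (use \<open>\<eta> > 0\<close> in simp)
    ultimately have "eventually (\<lambda>n. f (v - x n) - e n * norm (x n - v)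
        \<le> A u (v - u) + \<phi> u v - \<phi> u u + clarke_deriv j u (v - u) + \<eta>) sequentially"
    proof eventually_elim
      case (elim n)
      have "- e n * norm (x n - v) \<le> (A (x n) - f) (v - x n) + \<phi> (x n) v - \<phi> (x n) (x n)
          + clarke_deriv j (x n) (v - x n)"
        using approx[of n] v unfolding vhi_approx_set_def by blast
      with elim show ?case
        by (simp add: blinfun.diff_left)
    qed
    moreover have "(\<lambda>n. f (v - x n) - e n * norm (x n - v)) \<longlonglongrightarrow> f (v - u) - 0 * norm (u - v)"
      by (intro tendsto_intros x e)
    ultimately show "f (v - u) \<le> A u (v - u) + \<phi> u v - \<phi> u u + clarke_deriv j u (v - u) + \<eta>"
      using tendsto_upperbound[OF _ _ sequentially_bot] by fastforce
  qed
qed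

text \<open>
  This is Cantor's intersection argument: the sets \<open>\<Omega>(\<epsilon>)\<close> need not be closed, but the limit of a
  sequence of points chosen from them is caught by the solution set.
\<close>

lemma vhi_solution_exists:
  fixes K :: "'a::banach set"
  assumes K: "closed K" and A: "pseudomonotone A"
    and \<phi>: "\<And>x u v. x \<longlonglongrightarrow> u \<Longrightarrow>
      limsup (\<lambda>n. ereal (\<phi> (x n) v - \<phi> (x n) (x n))) \<le> ereal (\<phi> u v - \<phi> u u)"
    and j: "locally_lipschitz j"
    and nonempty: "\<And>\<epsilon>. \<epsilon> > 0 \<Longrightarrow> vhi_approx_set K A \<phi> j f \<epsilon> \<noteq> {}"
    and diam: "((\<lambda>\<epsilon>. ediam (vhi_approx_set K A \<phi> j f \<epsilon>)) \<longlongrightarrow> 0) (at_right 0)"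
  shows "vhi_solutions K A \<phi> j f \<noteq> {}"
proof -
  define \<Omega> where "\<Omega> = vhi_approx_set K A \<phi> j f"
  have mono: "\<Omega> \<epsilon> \<subseteq> \<Omega> \<delta>" if "\<epsilon> \<le> \<delta>" for \<epsilon> \<delta>
    using that by (simp add: \<Omega>_def vhi_approx_set_mono)
  have small: "\<exists>\<delta>>0. \<forall>a\<in>\<Omega> \<delta>. \<forall>b\<in>\<Omega> \<delta>. norm (a - b) < r" if "r > 0" for r
    using ediam_tendsto_0_iff[of \<Omega>] mono nonempty diam that unfolding \<Omega>_def by blast
  define e where "e n = inverse (real (Suc n))" for n
  have e: "e n > 0" "e \<longlonglongrightarrow> 0" for n
    unfolding e_def by (simp, rule LIMSEQ_inverse_real_of_nat)
  have "\<forall>n. \<exists>a. a \<in> \<Omega> (e n)"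
    using nonempty[OF e(1)] unfolding \<Omega>_def by blast
  then obtain x where x: "\<And>n. x n \<in> \<Omega> (e n)"
    by metis
  have "Cauchy x"
  proof (rule CauchyI)
    fix r :: real assume "r > 0"
    then obtain d where "d > 0" and d: "\<forall>a\<in>\<Omega> d. \<forall>b\<in>\<Omega> d. norm (a - b) < r"
      using small by blast
    have "eventually (\<lambda>n. e n < d) sequentially"
      using e(2) \<open>d > 0\<close> by (rule order_tendstoD)
    then obtain N where "\<And>n. n \<ge> N \<Longrightarrow> e n < d"
      by (auto simp: eventually_sequentially)
    then have "x n \<in> \<Omega> d" if "n \<ge> N" for n
      using x[of n] mono[of "e n" d] that by (auto simp: less_imp_le)
    then show "\<exists>N. \<forall>m\<ge>N. \<forall>n\<ge>N. norm (x m - x n) < r"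
      using d by blast
  qed
  then obtain u where u: "x \<longlonglongrightarrow> u"
    using Cauchy_convergent_iff convergent_def by blast
  have "u \<in> vhi_solutions K A \<phi> j f"
    by (rule limit_of_approx_points_is_solution[OF K A \<phi>[OF u] j u e(2) x[unfolded \<Omega>_def]])
  then show ?thesis
    by blast
qed

theorem theorem9:
  fixes K :: "'a::banach set"
    and A :: "'a \<Rightarrow> 'a \<Rightarrow>\<^sub>L real"
    and \<phi> :: "'a \<Rightarrow> 'a \<Rightarrow> real"
    and j :: "'a \<Rightarrow> real"
    and f :: "'a \<Rightarrow>\<^sub>L real"
  assumes "K \<noteq> {}"
  shows "(locally_lipschitz j \<longrightarrow>
      (vhi_well_posed K A \<phi> j f \<longleftrightarrow>
        vhi_solutions K A \<phi> j f \<noteq> {} \<and>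
        ((\<lambda>\<epsilon>. ediam (vhi_approx_set K A \<phi> j f \<epsilon>)) \<longlongrightarrow> 0) (at_right 0))) \<and>
    (closed K \<and> pseudomonotone A \<and>
      (\<forall>x u v. x \<longlonglongrightarrow> u \<longrightarrow>
        limsup (\<lambda>n. ereal (\<phi> (x n) v - \<phi> (x n) (x n))) \<le> ereal (\<phi> u v - \<phi> u u)) \<and>
      locally_lipschitz j \<longrightarrow>
      (vhi_well_posed K A \<phi> j f \<longleftrightarrow>
        (\<forall>\<epsilon>>0. vhi_approx_set K A \<phi> j f \<epsilon> \<noteq> {}) \<and>
        ((\<lambda>\<epsilon>. ediam (vhi_approx_set K A \<phi> j f \<epsilon>)) \<longlongrightarrow> 0) (at_right 0)))"
proof (intro conjI impI)
  show "vhi_well_posed K A \<phi> j f \<longleftrightarrow> vhi_solutions K A \<phi> j f \<noteq> {} \<and>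
      ((\<lambda>\<epsilon>. ediam (vhi_approx_set K A \<phi> j f \<epsilon>)) \<longlongrightarrow> 0) (at_right 0)"
    by (rule vhi_well_posed_iff_diam)
next
  assume "closed K \<and> pseudomonotone A \<and>
      (\<forall>x u v. x \<longlonglongrightarrow> u \<longrightarrow>
        limsup (\<lambda>n. ereal (\<phi> (x n) v - \<phi> (x n) (x n))) \<le> ereal (\<phi> u v - \<phi> u u)) \<and>
      locally_lipschitz j"
  then have "vhi_solutions K A \<phi> j f \<noteq> {}"
    if "\<forall>\<epsilon>>0. vhi_approx_set K A \<phi> j f \<epsilon> \<noteq> {}"
      and "((\<lambda>\<epsilon>. ediam (vhi_approx_set K A \<phi> j f \<epsilon>)) \<longlongrightarrow> 0) (at_right 0)"
    using that by (intro vhi_solution_exists) auto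
  moreover have "\<forall>\<epsilon>>0. vhi_approx_set K A \<phi> j f \<epsilon> \<noteq> {}" if "vhi_solutions K A \<phi> j f \<noteq> {}"
    using that vhi_solutions_subset_approx[of _ K A \<phi> j f] by (metis less_imp_le subset_empty)
  ultimately show "vhi_well_posed K A \<phi> j f \<longleftrightarrow>
        (\<forall>\<epsilon>>0. vhi_approx_set K A \<phi> j f \<epsilon> \<noteq> {}) \<and>
        ((\<lambda>\<epsilon>. ediam (vhi_approx_set K A \<phi> j f \<epsilon>)) \<longlongrightarrow> 0) (at_right 0)"
    unfolding vhi_well_posed_iff_diam by blast
qed

end
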